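(* Let $Z=\sum_{i=1}^{k}\sum_{e=1}^{l_i}Z^{(i)}_e$ be a bags-of-dice martingale of $d\times d$ matrices with respect to random variables $(r_1,R^{(1)},\dots,r_k,R^{(k)})$, and let $\epsilon>0$. Then the associated $\epsilon$-truncated martingale $\widetilde{Z}$ is also a bags-of-dice martingale (with respect to the same random variables), and \[\Pr[-\epsilon I\not\preceq Z\text{ or }Z\not\preceq\epsilon I]\le\Pr[-\epsilon I\not\preceq\widetilde{Z}\text{ or }\widetilde{Z}\not\preceq\epsilon I].\]
   Context: A bags-of-dice martingale is a sum $Z=\sum_{i=1}^{k}\sum_{e=1}^{l_i}Z^{(i)}_e$ of random $d\times d$ matrices together with a sequence of random variables $(r_1,R^{(1)},\dots,r_k,R^{(k)})$ such that for all $1\le i\le k$: conditional on $(r_1,R^{(1)},\dots,r_{i-1},R^{(i-1)})$ (denoted "$(i-1)$") and $r_i$, $l_i$ is a fixed non-negative integer and $R^{(i)}=(R^{(i)}_1,\dots,R^{(i)}_{l_i})$ is a tuple of $l_i$ independent random variables; conditional on $(i-1)$ and $r_i$, each $Z^{(i)}_e$ is a symmetric matrix that is a deterministic function of $R^{(i)}_e$; and $\mathbb{E}_{R^{(i)}_e}[Z^{(i)}_e\mid(i-1),r_i]=0$. For $h\in\{1,\dots,k+1\}$, $\mathcal{A}_h$ is the event that for all $1\le j<h$, $\sum_{i=1}^{j}\sum_{e=1}^{l_i}Z^{(i)}_e\preceq\epsilon I$. The $\epsilon$-truncated martingale is $\widetilde{Z}=\sum_{i=1}^{k}\mathbb{1}_{\mathcal{A}_i}\sum_{e=1}^{l_i}Z^{(i)}_e$.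 $A\preceq B$ means $B-A$ is positive semidefinite. *)

theory Defs
  imports "HOL-Probability.Probability"
begin

definition psd_mat :: "real^'n^'n \<Rightarrow> bool" where
  "psd_mat A \<longleftrightarrow> transpose A = A \<and> (\<forall>x. 0 \<le> x \<bullet> (A *v x))"

definition loewner_le :: "real^'n^'n \<Rightarrow> real^'n^'n \<Rightarrow> bool" (infix "\<preceq>" 50) where
  "A \<preceq> B \<longleftrightarrow> psd_mat (B - A)"

(* Bags and dice are numbered from 1. The i-th bag is a tuple of random length l i:
   R i e and Z i e are meaningful only where 1 <= e <= l i, and their values elsewhere
   are never used. The dice take values in the measurable spaces NR i e, and the
   r i take values in the measurable spaces Nr i. *)

definition die_event ::
  "'a measure \<Rightarrow> (nat \<Rightarrow> 'a \<Rightarrow> nat) \<Rightarrow> (nat \<Rightarrow> nat \<Rightarrow> 'a \<Rightarrow> 'b) \<Rightarrow> nat \<Rightarrow> nat \<Rightarrow> 'b set \<Rightarrow> 'a set" where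
  "die_event M l R i e A = {\<omega> \<in> space M. e \<le> l i \<omega> \<and> R i e \<omega> \<in> A}"

(* The sigma-algebra generated by (r_1, R^(1), ..., r_(i-1), R^(i-1)) and r_i.
   Being conditional on "(i-1)" and r_i means conditioning on this sigma-algebra. *)

definition history ::
  "'a measure \<Rightarrow> (nat \<Rightarrow> 'r measure) \<Rightarrow> (nat \<Rightarrow> 'a \<Rightarrow> 'r) \<Rightarrow> (nat \<Rightarrow> 'a \<Rightarrow> nat) \<Rightarrow>
   (nat \<Rightarrow> nat \<Rightarrow> 'b measure) \<Rightarrow> (nat \<Rightarrow> nat \<Rightarrow> 'a \<Rightarrow> 'b) \<Rightarrow> nat \<Rightarrow> 'a measure" where
  "history M Nr r l NR R i = sigma (space M)
     ({r j -` A \<inter> space M | j A. j \<in> {1..i} \<and> A \<in> sets (Nr j)} \<union>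
      {die_event M l R j e A | j e A. j \<in> {1..<i} \<and> 1 \<le> e \<and> A \<in> sets (NR j e)})"

(* The requirements are imposed as follows.
   - "Conditional on the history, Z i e is a deterministic function of R i e" is the
     existence of a jointly measurable f, depending on \<omega> through the history only, with
     Z i e \<omega> = f (\<omega>, R i e \<omega>).
   - Independence of a bag is conditional independence given the history; both sides are
     conditional probabilities.
   - The zero-mean condition is entrywise. Only conditional integrability is required; it
     must be stated separately because real_cond_exp is total and has the value 0 where
     the conditional expectations of the positive and negative parts are infinite. *)

locale bags_of_dice = prob_space M for M :: "'a measure" +
  fixes k :: nat
    and Nr :: "nat \<Rightarrow> 'r measure" and r :: "nat \<Rightarrow> 'a \<Rightarrow> 'r"
    and l :: "nat \<Rightarrow> 'a \<Rightarrow> nat"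
    and NR :: "nat \<Rightarrow> nat \<Rightarrow> 'b measure" and R :: "nat \<Rightarrow> nat \<Rightarrow> 'a \<Rightarrow> 'b"
    and Z :: "nat \<Rightarrow> nat \<Rightarrow> 'a \<Rightarrow> real^'n^'n"
    and Ztot :: "'a \<Rightarrow> real^'n^'n"
  assumes total: "\<And>\<omega>. \<omega> \<in> space M \<Longrightarrow> Ztot \<omega> = (\<Sum>i=1..k. \<Sum>e=1..l i \<omega>. Z i e \<omega>)"
    and measurable_r: "\<And>i. i \<in> {1..k} \<Longrightarrow> r i \<in> measurable M (Nr i)"
    and length_fixed:
      "\<And>i. i \<in> {1..k} \<Longrightarrow> l i \<in> measurable (history M Nr r l NR R i) (count_space UNIV)"
    and measurable_R: "\<And>i e. i \<in> {1..k} \<Longrightarrow> 1 \<le> e \<Longrightarrow>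
      R i e \<in> measurable (restrict_space M {\<omega> \<in> space M. e \<le> l i \<omega>}) (NR i e)"
    and indep_dice: "\<And>i J A. i \<in> {1..k} \<Longrightarrow> finite J \<Longrightarrow> J \<noteq> {} \<Longrightarrow> J \<subseteq> {1..} \<Longrightarrow>
      (\<And>e. e \<in> J \<Longrightarrow> A e \<in> sets (NR i e)) \<Longrightarrow>
      AE \<omega> in M. J \<subseteq> {1..l i \<omega>} \<longrightarrow>
        real_cond_exp M (history M Nr r l NR R i)
          (indicator (\<Inter>e\<in>J. die_event M l R i e (A e))) \<omega> =
        (\<Prod>e\<in>J. real_cond_exp M (history M Nr r l NR R i)
          (indicator (die_event M l R i e (A e))) \<omega>)"
    and function_of_die: "\<And>i e. i \<in> {1..k} \<Longrightarrow> 1 \<le> e \<Longrightarrow>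
      \<exists>f \<in> borel_measurable (history M Nr r l NR R i \<Otimes>\<^sub>M NR i e).
        \<forall>\<omega>\<in>space M. e \<le> l i \<omega> \<longrightarrow> Z i e \<omega> = f (\<omega>, R i e \<omega>)"
    and symmetric: "\<And>i e \<omega>. i \<in> {1..k} \<Longrightarrow> \<omega> \<in> space M \<Longrightarrow> e \<in> {1..l i \<omega>} \<Longrightarrow>
      transpose (Z i e \<omega>) = Z i e \<omega>"
    and cond_integrable: "\<And>i e a b. i \<in> {1..k} \<Longrightarrow> 1 \<le> e \<Longrightarrow>
      AE \<omega> in M. e \<le> l i \<omega> \<longrightarrow>
        nn_cond_exp M (history M Nr r l NR R i)
          (\<lambda>x. if e \<le> l i x then ennreal \<bar>Z i e x $ a $ b\<bar> else 0) \<omega> < \<infinity>"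
    and mean_zero: "\<And>i e a b. i \<in> {1..k} \<Longrightarrow> 1 \<le> e \<Longrightarrow>
      AE \<omega> in M. e \<le> l i \<omega> \<longrightarrow>
        real_cond_exp M (history M Nr r l NR R i)
          (\<lambda>x. if e \<le> l i x then Z i e x $ a $ b else 0) \<omega> = 0"

definition bounded_before ::
  "'a measure \<Rightarrow> (nat \<Rightarrow> 'a \<Rightarrow> nat) \<Rightarrow> (nat \<Rightarrow> nat \<Rightarrow> 'a \<Rightarrow> real^'n^'n) \<Rightarrow> real \<Rightarrow> nat \<Rightarrow> 'a set" where
  "bounded_before M l Z \<epsilon> h =
     {\<omega> \<in> space M. \<forall>j. 1 \<le> j \<and> j < h \<longrightarrow>
        (\<Sum>i=1..j. \<Sum>e=1..l i \<omega>. Z i e \<omega>) \<preceq> \<epsilon> *\<^sub>R mat 1}"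

definition truncated_dice ::
  "'a measure \<Rightarrow> (nat \<Rightarrow> 'a \<Rightarrow> nat) \<Rightarrow> (nat \<Rightarrow> nat \<Rightarrow> 'a \<Rightarrow> real^'n^'n) \<Rightarrow> real \<Rightarrow>
   nat \<Rightarrow> nat \<Rightarrow> 'a \<Rightarrow> real^'n^'n" where
  "truncated_dice M l Z \<epsilon> i e \<omega> = indicator (bounded_before M l Z \<epsilon> i) \<omega> *\<^sub>R Z i e \<omega>"

definition truncated_total ::
  "'a measure \<Rightarrow> nat \<Rightarrow> (nat \<Rightarrow> 'a \<Rightarrow> nat) \<Rightarrow> (nat \<Rightarrow> nat \<Rightarrow> 'a \<Rightarrow> real^'n^'n) \<Rightarrow> real \<Rightarrow>
   'a \<Rightarrow> real^'n^'n" where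
  "truncated_total M k l Z \<epsilon> \<omega> =
     (\<Sum>i=1..k. indicator (bounded_before M l Z \<epsilon> i) \<omega> *\<^sub>R (\<Sum>e=1..l i \<omega>. Z i e \<omega>))"

end

(* Each event A_i depends only on the bags before the i-th, so it belongs to the i-th history
   sigma-algebra. Its indicator therefore factors out of the conditional expectations, which
   keeps the means zero. Pointwise, the truncated sum is Z if no partial sum before the k-th
   exceeds epsilon I; otherwise it is the first partial sum that does, so a bad event for Z is
   always a bad event for the truncated sum. *)
theory Submission
  imports Defs
begin

section \<open>Measurability of the Loewner order\<close>

lemma closed_psd_mat: "closed {A :: real^'n^'n. psd_mat A}"
proof -
  \<comment> \<open>Written in entries, every condition is an equation or a weak inequality between
    continuous functions of \<open>A\<close>, so the set is an intersection of closed sets.\<close>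
  have "psd_mat A \<longleftrightarrow> (\<forall>i j. A $ j $ i = A $ i $ j) \<and>
      (\<forall>x. 0 \<le> (\<Sum>i\<in>UNIV. x $ i * (\<Sum>j\<in>UNIV. A $ i $ j * x $ j)))" for A :: "real^'n^'n"
    by (simp add: psd_mat_def transpose_def vec_eq_iff inner_vec_def matrix_vector_mult_def)
  then show ?thesis
    by (simp only:) (intro closed_Collect_conj closed_Collect_all closed_Collect_eq
      closed_Collect_le continuous_intros)
qed

lemma pred_loewner_le [measurable (raw)]:
  assumes [measurable]: "f \<in> borel_measurable N" "g \<in> borel_measurable N"
  shows "Measurable.pred N (\<lambda>\<omega>. f \<omega> \<preceq> (g \<omega> :: real^'n^'n))"
proof -
  have "(\<lambda>\<omega>. g \<omega> - f \<omega>) -` {A. psd_mat A} \<inter> space N \<in> sets N"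
    by (intro measurable_sets[OF borel_measurable_diff borel_closed] assms closed_psd_mat)
  then show ?thesis
    by (simp add: pred_def loewner_le_def vimage_def Int_def conj_commute)
qed

text \<open>The entries of a die are only conditionally integrable, so the library's
  \<open>real_cond_exp_mult\<close> does not apply to them.\<close>

lemma (in sigma_finite_subalgebra) real_cond_exp_indicator_times:
  assumes B: "B \<in> sets F" and g [measurable]: "g \<in> borel_measurable M"
  shows "AE \<omega> in M. real_cond_exp M F (\<lambda>x. indicator B x * g x) \<omega> =
    indicator B \<omega> * real_cond_exp M F g \<omega>"
proof -
  \<comment> \<open>The indicator is nonnegative, so it scales the positive and the negative part
    separately. Each part has a nonnegative conditional expectation, out of which it factors without
    integrability.\<close>
  have split: "ennreal (indicator B x * g x) = indicator B x * ennreal (g x)"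
    "ennreal (- (indicator B x * g x)) = indicator B x * ennreal (- g x)" for x
    by (auto simp: indicator_def)
  have ind: "(indicator B :: 'a \<Rightarrow> ennreal) \<in> borel_measurable F"
    using B by measurable
  have "AE \<omega> in M. indicator B \<omega> * nn_cond_exp M F (\<lambda>x. ennreal (g x)) \<omega> =
      nn_cond_exp M F (\<lambda>x. indicator B x * ennreal (g x)) \<omega>"
    using nn_cond_exp_prod[OF ind, of "\<lambda>x. ennreal (g x)"] by simp
  moreover have "AE \<omega> in M. indicator B \<omega> * nn_cond_exp M F (\<lambda>x. ennreal (- g x)) \<omega> =
      nn_cond_exp M F (\<lambda>x. indicator B x * ennreal (- g x)) \<omega>"
    using nn_cond_exp_prod[OF ind, of "\<lambda>x. ennreal (- g x)"] by simp
  ultimately show ?thesis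
  proof eventually_elim
    case (elim \<omega>)
    \<comment> \<open>The factor is 1 or 0 at the given point, so the difference of the two parts
      scales correctly even where one of them is infinite.\<close>
    then show ?case
      unfolding real_cond_exp_def split
      by (cases "\<omega> \<in> B") (simp_all flip: elim)
  qed
qed

section \<open>History sigma-algebras and measurability of bags\<close>

context bags_of_dice
begin

abbreviation hist :: "nat \<Rightarrow> 'a measure" where
  "hist \<equiv> history M Nr r l NR R"

lemma space_history [simp]: "space (hist i) = space M"
  by (auto simp: history_def die_event_def intro!: space_measure_of)

lemma sets_history:
  "sets (hist i) = sigma_sets (space M)
     ({r j -` A \<inter> space M | j A. j \<in> {1..i} \<and> A \<in> sets (Nr j)} \<union>
      {die_event M l R j e A | j e A. j \<in> {1..<i} \<and> 1 \<le> e \<and> A \<in> sets (NR j e)})"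
  unfolding history_def by (rule sets_measure_of) (auto simp: die_event_def)

lemma subalgebra_history_mono: "i \<le> j \<Longrightarrow> subalgebra (hist j) (hist i)"
  unfolding subalgebra_def sets_history space_history
  by (intro conjI refl sigma_sets_mono') fastforce

text \<open>Strong induction, because a die event of bag j < i lies in \<open>M\<close> only if
  \<open>l j\<close> is measurable there. \<open>length_fixed\<close> gives measurability in
  \<open>hist j\<close>, which must already be known to be part of \<open>M\<close>.\<close>

lemma subalgebra_history: "i \<le> k \<Longrightarrow> subalgebra M (hist i)"
proof (induction i rule: less_induct)
  case (less i)
  have "r j -` A \<inter> space M \<in> sets M" if "j \<in> {1..i}" "A \<in> sets (Nr j)" for j A
    using that less.prems by (intro measurable_sets[OF measurable_r]) auto
  moreover have "die_event M l R j e A \<in> sets M"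
    if j: "j \<in> {1..<i}" and e: "1 \<le> e" and A: "A \<in> sets (NR j e)" for j e A
  proof -
    have "l j \<in> measurable M (count_space UNIV)"
      using less j by (intro measurable_from_subalg[OF less.IH length_fixed]) auto
    then have S: "{\<omega> \<in> space M. e \<le> l j \<omega>} \<in> sets M"
      by measurable
    have "R j e -` A \<inter> space (restrict_space M {\<omega> \<in> space M. e \<le> l j \<omega>})
        \<in> sets (restrict_space M {\<omega> \<in> space M. e \<le> l j \<omega>})"
      using less.prems j e A by (intro measurable_sets[OF measurable_R]) auto
    moreover have "R j e -` A \<inter> space (restrict_space M {\<omega> \<in> space M. e \<le> l j \<omega>}) =
        die_event M l R j e A"
      by (auto simp: die_event_def space_restrict_space)
    ultimately show ?thesis
      using S by (simp add: sets_restrict_space_iff)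
  qed
  ultimately show ?case
    unfolding subalgebra_def sets_history space_history
    by (intro conjI refl sets.sigma_sets_subset) auto
qed

text \<open>On the region where the die exists, its preimages are exactly die events, and these are
  generators of every strictly later history.\<close>

lemma measurable_die_history:
  assumes i: "i \<in> {1..k}" and e: "1 \<le> e" and ij: "i < j"
  shows "R i e \<in> measurable (restrict_space (hist j) {\<omega> \<in> space M. e \<le> l i \<omega>}) (NR i e)"
proof (rule measurableI)
  fix \<omega> assume "\<omega> \<in> space (restrict_space (hist j) {\<omega> \<in> space M. e \<le> l i \<omega>})"
  then show "R i e \<omega> \<in> space (NR i e)"
    using measurable_space[OF measurable_R[OF i e]] by (simp add: space_restrict_space)
next
  fix A assume A: "A \<in> sets (NR i e)"
  have [measurable]: "l i \<in> measurable (hist j) (count_space UNIV)"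
    using ij by (intro measurable_from_subalg[OF subalgebra_history_mono length_fixed[OF i]]) simp
  have "{\<omega> \<in> space (hist j). e \<le> l i \<omega>} \<in> sets (hist j)"
    by measurable
  then have S: "{\<omega> \<in> space M. e \<le> l i \<omega>} \<in> sets (hist j)"
    by simp
  have "die_event M l R i e A \<in> sets (hist j)"
    unfolding sets_history using i e ij A by (intro sigma_sets.Basic) auto
  moreover have "R i e -` A \<inter> space (restrict_space (hist j) {\<omega> \<in> space M. e \<le> l i \<omega>}) =
      die_event M l R i e A"
    by (auto simp: die_event_def space_restrict_space)
  ultimately show "R i e -` A \<inter> space (restrict_space (hist j) {\<omega> \<in> space M. e \<le> l i \<omega>})
      \<in> sets (restrict_space (hist j) {\<omega> \<in> space M. e \<le> l i \<omega>})"
    using sets.Int[OF S sets.top]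
    by (simp only: sets_restrict_space_iff) (auto simp: die_event_def)
qed

text \<open>A die's matrix is meaningful, and measurable, only where the die exists; hence the
  extension by 0.\<close>

lemma measurable_matrix_of_die:
  assumes sub: "subalgebra N (hist i)" and i: "i \<in> {1..k}" and e: "1 \<le> e"
    and R: "R i e \<in> measurable (restrict_space N {\<omega> \<in> space M. e \<le> l i \<omega>}) (NR i e)"
  shows "(\<lambda>\<omega>. if e \<le> l i \<omega> then Z i e \<omega> else 0) \<in> borel_measurable N"
proof -
  have space_N: "space N = space M"
    using sub by (simp add: subalgebra_def)
  have [measurable]: "l i \<in> measurable N (count_space UNIV)"
    by (rule measurable_from_subalg[OF sub length_fixed[OF i]])
  \<comment> \<open>Both ways of writing the region have the same trace on \<open>N\<close>. The
    form without \<open>space M\<close> is the one in the rule for case distinctions applied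
    below.\<close>
  have "{\<omega> \<in> space M. e \<le> l i \<omega>} \<inter> A = {\<omega>. e \<le> l i \<omega>} \<inter> A" if "A \<in> sets N" for A
    using sets.sets_into_space[OF that] space_N by auto
  then have "(\<inter>) {\<omega> \<in> space M. e \<le> l i \<omega>} ` sets N = (\<inter>) {\<omega>. e \<le> l i \<omega>} ` sets N"
    by (rule image_cong[OF refl])
  moreover have "{\<omega> \<in> space M. e \<le> l i \<omega>} \<inter> space N = {\<omega>. e \<le> l i \<omega>} \<inter> space N"
    using space_N by auto
  ultimately have eq:
    "restrict_space N {\<omega> \<in> space M. e \<le> l i \<omega>} = restrict_space N {\<omega>. e \<le> l i \<omega>}"
    unfolding restrict_space_def by (simp only:)
  obtain f where f: "f \<in> borel_measurable (hist i \<Otimes>\<^sub>M NR i e)"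
    and Z: "\<And>\<omega>. \<omega> \<in> space M \<Longrightarrow> e \<le> l i \<omega> \<Longrightarrow> Z i e \<omega> = f (\<omega>, R i e \<omega>)"
    using function_of_die[OF i e] by blast
  \<comment> \<open>\<open>f\<close> sees the sample point only through the history, so the identity
    into \<open>hist i\<close>, paired with the die, is a measurable argument for it.\<close>
  have id: "(\<lambda>\<omega>. \<omega>) \<in> measurable (restrict_space N {\<omega>. e \<le> l i \<omega>}) (hist i)"
    by (intro measurable_restrict_space1 measurable_from_subalg[OF sub] measurable_ident_sets) simp
  have "(\<lambda>\<omega>. f (\<omega>, R i e \<omega>)) \<in> borel_measurable (restrict_space N {\<omega>. e \<le> l i \<omega>})"
    using R unfolding eq by (intro measurable_compose[OF measurable_Pair[OF id] f])
  then have "(\<lambda>\<omega>. if e \<le> l i \<omega> then f (\<omega>, R i e \<omega>) else 0) \<in> borel_measurable N"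
    by (subst measurable_If_restrict_space_iff) auto
  then show ?thesis
    by (rule measurable_cong[THEN iffD1, rotated]) (auto simp: space_N Z)
qed

text \<open>\<open>N\<close> is left general to cover two cases: a later history, for the truncation
  events, and \<open>M\<close> itself, for the truncated total.\<close>

lemma measurable_bag_sum:
  assumes sub: "subalgebra N (hist i)" and i: "i \<in> {1..k}"
    and R: "\<And>e. 1 \<le> e \<Longrightarrow>
      R i e \<in> measurable (restrict_space N {\<omega> \<in> space M. e \<le> l i \<omega>}) (NR i e)"
  shows "(\<lambda>\<omega>. \<Sum>e=1..l i \<omega>. Z i e \<omega>) \<in> borel_measurable N"
proof -
  have l: "l i \<in> measurable N (count_space UNIV)"
    by (rule measurable_from_subalg[OF sub length_fixed[OF i]])
  \<comment> \<open>The number of summands is random: first fix it to \<open>n\<close>, then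
    substitute the countably valued \<open>l i\<close>. For indices up to \<open>l i\<close> the
    extension by 0 changes nothing.\<close>
  have "(\<lambda>\<omega>. \<Sum>e=1..n. if e \<le> l i \<omega> then Z i e \<omega> else 0) \<in> borel_measurable N" for n
    using measurable_matrix_of_die[OF sub i _ R] by (intro borel_measurable_sum) simp
  from measurable_compose_countable[OF this l]
  have "(\<lambda>\<omega>. \<Sum>e=1..l i \<omega>. if e \<le> l i \<omega> then Z i e \<omega> else 0) \<in> borel_measurable N" .
  also have "(\<lambda>\<omega>. \<Sum>e=1..l i \<omega>. if e \<le> l i \<omega> then Z i e \<omega> else 0) =
      (\<lambda>\<omega>. \<Sum>e=1..l i \<omega>. Z i e \<omega>)"
    by (intro ext sum.cong) auto
  finally show ?thesis .
qed

lemma bounded_before_in_history: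
  assumes "i \<le> k"
  shows "bounded_before M l Z \<epsilon> i \<in> sets (hist i)"
proof -
  \<comment> \<open>Every bag \<open>h\<close> in this sum satisfies h \<le> j < i, so it is
    strictly in the past of \<open>hist i\<close>.\<close>
  have S: "(\<lambda>\<omega>. \<Sum>h=1..j. \<Sum>e=1..l h \<omega>. Z h e \<omega>) \<in> borel_measurable (hist i)"
    if "j < i" for j
    using that assms
    by (intro borel_measurable_sum measurable_bag_sum subalgebra_history_mono
        measurable_die_history) auto
  have "{\<omega> \<in> space (hist i). \<forall>j\<in>{1..<i}.
      (\<Sum>h=1..j. \<Sum>e=1..l h \<omega>. Z h e \<omega>) \<preceq> \<epsilon> *\<^sub>R mat 1} \<in> sets (hist i)"
    unfolding pred_def[symmetric] by (intro pred_intros_finite pred_loewner_le S borel_measurable_const) simp_all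
  also have "{\<omega> \<in> space (hist i). \<forall>j\<in>{1..<i}.
      (\<Sum>h=1..j. \<Sum>e=1..l h \<omega>. Z h e \<omega>) \<preceq> \<epsilon> *\<^sub>R mat 1} = bounded_before M l Z \<epsilon> i"
    by (auto simp: bounded_before_def)
  finally show ?thesis .
qed

lemma truncated_total_measurable:
  "truncated_total M k l Z \<epsilon> \<in> borel_measurable M"
proof -
  have "(\<lambda>\<omega>. \<Sum>e=1..l i \<omega>. Z i e \<omega>) \<in> borel_measurable M" if "i \<in> {1..k}" for i
    using that by (intro measurable_bag_sum[OF subalgebra_history] measurable_R) auto
  moreover have "bounded_before M l Z \<epsilon> i \<in> sets M" if "i \<in> {1..k}" for i
    using that subalgebra_history[of i] bounded_before_in_history[of i \<epsilon>]
    by (auto simp: subalgebra_def)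
  ultimately show ?thesis
    unfolding truncated_total_def
    by (intro borel_measurable_sum borel_measurable_scaleR borel_measurable_indicator) auto
qed

section \<open>The truncated sum is a bags-of-dice martingale\<close>

lemma bags_of_dice_truncated:
  "bags_of_dice M k Nr r l NR R (truncated_dice M l Z \<epsilon>) (truncated_total M k l Z \<epsilon>)"
proof unfold_locales
  let ?B = "bounded_before M l Z \<epsilon>" and ?T = "truncated_dice M l Z \<epsilon>"
  show "truncated_total M k l Z \<epsilon> \<omega> = (\<Sum>i=1..k. \<Sum>e=1..l i \<omega>. ?T i e \<omega>)" for \<omega>
    by (simp add: truncated_total_def truncated_dice_def scaleR_sum_right)
  \<comment> \<open>The conditions on \<open>r\<close>, \<open>l\<close> and \<open>R\<close>,
    including independence, do not mention the matrices and carry over verbatim.\<close>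
  show "r i \<in> measurable M (Nr i)" if "i \<in> {1..k}" for i
    by (rule measurable_r[OF that])
  show "l i \<in> measurable (hist i) (count_space UNIV)" if "i \<in> {1..k}" for i
    by (rule length_fixed[OF that])
  show "R i e \<in> measurable (restrict_space M {\<omega> \<in> space M. e \<le> l i \<omega>}) (NR i e)"
    if "i \<in> {1..k}" "1 \<le> e" for i e
    by (rule measurable_R[OF that])
  show "AE \<omega> in M. J \<subseteq> {1..l i \<omega>} \<longrightarrow>
        real_cond_exp M (hist i) (indicator (\<Inter>e\<in>J. die_event M l R i e (A e))) \<omega> =
        (\<Prod>e\<in>J. real_cond_exp M (hist i) (indicator (die_event M l R i e (A e))) \<omega>)"
    if "i \<in> {1..k}" "finite J" "J \<noteq> {}" "J \<subseteq> {1..}" "\<And>e. e \<in> J \<Longrightarrow> A e \<in> sets (NR i e)"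
    for i J A
    by (rule indep_dice[OF that])
  show "\<exists>f\<in>borel_measurable (hist i \<Otimes>\<^sub>M NR i e).
      \<forall>\<omega>\<in>space M. e \<le> l i \<omega> \<longrightarrow> ?T i e \<omega> = f (\<omega>, R i e \<omega>)"
    if i: "i \<in> {1..k}" and e: "1 \<le> e" for i e
  proof -
    obtain f where [measurable]: "f \<in> borel_measurable (hist i \<Otimes>\<^sub>M NR i e)"
      and Z: "\<And>\<omega>. \<omega> \<in> space M \<Longrightarrow> e \<le> l i \<omega> \<Longrightarrow> Z i e \<omega> = f (\<omega>, R i e \<omega>)"
      using function_of_die[OF i e] by blast
    have [measurable]: "?B i \<in> sets (hist i)"
      using i by (intro bounded_before_in_history) simp
    \<comment> \<open>The witness is the old function times the indicator at the first component;
      the event lies in \<open>hist i\<close>, so joint measurability is kept.\<close>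
    have "(\<lambda>p. indicator (?B i) (fst p) *\<^sub>R f p) \<in> borel_measurable (hist i \<Otimes>\<^sub>M NR i e)"
      by measurable
    then show ?thesis
      by (rule bexI[rotated]) (simp add: truncated_dice_def Z)
  qed
  show "transpose (?T i e \<omega>) = ?T i e \<omega>"
    if "i \<in> {1..k}" "\<omega> \<in> space M" "e \<in> {1..l i \<omega>}" for i e \<omega>
    using symmetric[OF that] by (simp add: truncated_dice_def transpose_scalar)
  fix i e :: nat and a b assume i: "i \<in> {1..k}" and e: "1 \<le> e"
  have sub: "subalgebra M (hist i)" and B: "?B i \<in> sets (hist i)"
    using i by (auto intro: subalgebra_history bounded_before_in_history)
  interpret finite_measure_subalgebra M "hist i"
    by unfold_locales (rule sub)
  let ?z = "\<lambda>x. if e \<le> l i x then Z i e x $ a $ b else 0"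
  have "(\<lambda>x. (if e \<le> l i x then Z i e x else 0) $ a $ b) \<in> borel_measurable M"
    using measurable_matrix_of_die[OF sub i e measurable_R[OF i e]]
    by (rule measurable_compose[where g = "\<lambda>A. A $ a $ b"])
      (intro borel_measurable_continuous_onI continuous_intros)
  also have "(\<lambda>x. (if e \<le> l i x then Z i e x else 0) $ a $ b) = ?z"
    by auto
  finally have z [measurable]: "?z \<in> borel_measurable M" .
  have [measurable]: "?B i \<in> sets M"
    using sub B by (auto simp: subalgebra_def)
  \<comment> \<open>Truncation commutes with the extension by 0, so each entry becomes a
    history-measurable indicator times the old entry.\<close>
  have trunc: "(if e \<le> l i x then ?T i e x $ a $ b else 0) = indicator (?B i) x * ?z x" for x
    by (simp add: truncated_dice_def)
  have abs_trunc: "(if e \<le> l i x then ennreal \<bar>?T i e x $ a $ b\<bar> else 0) =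
      ennreal \<bar>indicator (?B i) x * ?z x\<bar>" for x
    by (simp add: truncated_dice_def)
  have abs_z: "(if e \<le> l i x then ennreal \<bar>Z i e x $ a $ b\<bar> else 0) = ennreal \<bar>?z x\<bar>" for x
    by simp
  \<comment> \<open>Truncation can only decrease absolute values.\<close>
  have "AE \<omega> in M. nn_cond_exp M (hist i) (\<lambda>x. ennreal \<bar>indicator (?B i) x * ?z x\<bar>) \<omega> \<le>
      nn_cond_exp M (hist i) (\<lambda>x. ennreal \<bar>?z x\<bar>) \<omega>"
    by (rule nn_cond_exp_mono) (auto simp: indicator_def)
  then show "AE \<omega> in M. e \<le> l i \<omega> \<longrightarrow> nn_cond_exp M (hist i)
      (\<lambda>x. if e \<le> l i x then ennreal \<bar>?T i e x $ a $ b\<bar> else 0) \<omega> < \<infinity>"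
    using cond_integrable[OF i e, of a b] unfolding abs_trunc abs_z
    by eventually_elim (auto intro: le_less_trans)
  show "AE \<omega> in M. e \<le> l i \<omega> \<longrightarrow> real_cond_exp M (hist i)
      (\<lambda>x. if e \<le> l i x then ?T i e x $ a $ b else 0) \<omega> = 0"
    using real_cond_exp_indicator_times[OF B z] mean_zero[OF i e, of a b] unfolding trunc
    by eventually_elim auto
qed

end

section \<open>Pointwise comparison of the two sums\<close>

lemma truncated_total_eq:
  assumes "\<omega> \<in> bounded_before M l Z \<epsilon> k"
  shows "truncated_total M k l Z \<epsilon> \<omega> = (\<Sum>i=1..k. \<Sum>e=1..l i \<omega>. Z i e \<omega>)"
  \<comment> \<open>The events shrink as the index grows, so membership in the k-th makes all the
    indicators 1.\<close>
  using assms unfolding truncated_total_def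
  by (intro sum.cong) (auto simp: bounded_before_def indicator_def)

lemma truncated_total_not_le:
  fixes Z :: "nat \<Rightarrow> nat \<Rightarrow> 'a \<Rightarrow> real^'n^'n"
  assumes "\<omega> \<in> space M" and "\<omega> \<notin> bounded_before M l Z \<epsilon> k"
  shows "\<not> truncated_total M k l Z \<epsilon> \<omega> \<preceq> \<epsilon> *\<^sub>R mat 1"
proof -
  let ?S = "\<lambda>j. \<Sum>i=1..j. \<Sum>e=1..l i \<omega>. Z i e \<omega>"
  let ?bad = "\<lambda>j. 1 \<le> j \<and> j < k \<and> \<not> ?S j \<preceq> \<epsilon> *\<^sub>R mat 1"
  define j where "j = (LEAST j. ?bad j)"
  have "\<exists>j. ?bad j"
    using assms by (auto simp: bounded_before_def)
  then have bad: "?bad j"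
    unfolding j_def by (rule LeastI_ex)
  have before: "?S h \<preceq> \<epsilon> *\<^sub>R mat 1" if "1 \<le> h" "h < j" for h
    using not_less_Least[of h ?bad] that bad unfolding j_def[symmetric] by auto
  \<comment> \<open>The i-th event tests only sums before \<open>i\<close>. Hence bag
    \<open>j\<close>, which causes the first violation, is still counted: the bound is i \<le> j,
    not i < j.\<close>
  have ind: "\<omega> \<in> bounded_before M l Z \<epsilon> i \<longleftrightarrow> i \<le> j" for i
    using bad before assms(1) by (force simp: bounded_before_def not_le)
  have "truncated_total M k l Z \<epsilon> \<omega> =
      (\<Sum>i=1..k. if i \<le> j then \<Sum>e=1..l i \<omega>. Z i e \<omega> else 0)"
    unfolding truncated_total_def by (intro sum.cong) (auto simp: ind indicator_def)
  \<comment> \<open>Since j < k, the range 1..k contains all of 1..j, and the later terms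
    vanish.\<close>
  also have "\<dots> = ?S j"
    using bad by (intro sum.mono_neutral_cong_right) auto
  finally show ?thesis
    using bad by simp
qed

theorem theorem4p5:
  fixes M :: "'a measure" and k :: nat
    and Nr :: "nat \<Rightarrow> 'r measure" and r :: "nat \<Rightarrow> 'a \<Rightarrow> 'r"
    and l :: "nat \<Rightarrow> 'a \<Rightarrow> nat"
    and NR :: "nat \<Rightarrow> nat \<Rightarrow> 'b measure" and R :: "nat \<Rightarrow> nat \<Rightarrow> 'a \<Rightarrow> 'b"
    and Z :: "nat \<Rightarrow> nat \<Rightarrow> 'a \<Rightarrow> real^'n^'n"
    and Ztot :: "'a \<Rightarrow> real^'n^'n"
    and \<epsilon> :: real
  assumes "bags_of_dice M k Nr r l NR R Z Ztot"
    and "\<epsilon> > 0"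
  shows "bags_of_dice M k Nr r l NR R (truncated_dice M l Z \<epsilon>) (truncated_total M k l Z \<epsilon>) \<and>
    measure M {\<omega> \<in> space M.
        \<not> (- (\<epsilon> *\<^sub>R mat 1) \<preceq> Ztot \<omega>) \<or> \<not> (Ztot \<omega> \<preceq> \<epsilon> *\<^sub>R mat 1)}
    \<le> measure M {\<omega> \<in> space M.
        \<not> (- (\<epsilon> *\<^sub>R mat 1) \<preceq> truncated_total M k l Z \<epsilon> \<omega>) \<or>
        \<not> (truncated_total M k l Z \<epsilon> \<omega> \<preceq> \<epsilon> *\<^sub>R mat 1)}"
    (is "_ \<and> measure M ?E \<le> measure M ?E'")
proof
  interpret bags_of_dice M k Nr r l NR R Z Ztot
    by (rule assms(1))
  show "bags_of_dice M k Nr r l NR R (truncated_dice M l Z \<epsilon>) (truncated_total M k l Z \<epsilon>)"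
    by (rule bags_of_dice_truncated)
  have [measurable]: "truncated_total M k l Z \<epsilon> \<in> borel_measurable M"
    by (rule truncated_total_measurable)
  have "?E' \<in> sets M"
    by measurable
  moreover have "?E \<subseteq> ?E'"
  proof
    fix \<omega> assume \<omega>: "\<omega> \<in> ?E"
    show "\<omega> \<in> ?E'"
    proof (cases "\<omega> \<in> bounded_before M l Z \<epsilon> k")
      case True
      then have "truncated_total M k l Z \<epsilon> \<omega> = Ztot \<omega>"
        using \<omega> total[of \<omega>] truncated_total_eq[OF True] by auto
      then show ?thesis
        using \<omega> by simp
    next
      case False
      \<comment> \<open>Here the upper bound already fails for the truncated sum, which is the
        second disjunct of \<open>?E'\<close>.\<close>
      then show ?thesis
        using \<omega> truncated_total_not_le[OF _ False] by simp
    qed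
  qed
  ultimately show "measure M ?E \<le> measure M ?E'"
    by (intro finite_measure_mono)
qed

end
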